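(* Let $Q$ be an IPC formula and $\theta = (Z_N, \dots, Z_0)$ a finite sequence of IPC formulas, each of the form $QW$ or $QQW$ for some IPC formula $W$. Suppose some term of $\theta$ is a formula $\alpha = Q(X \supset Y)$ for IPC formulas $X, Y$, and put $\alpha_0 = QQX$, $\alpha_1 = QY$. If $\mathcal{D}(\alpha_0, \theta)$ is a theorem of IPC or $\mathcal{D}(\alpha_1, \theta)$ is a theorem of IPC, then $\mathcal{D}(\theta)$ is a theorem of IPC.
   Context: The Implicational Propositional Calculus (IPC) has formulas built from propositional variables using only $\supset$, the single inference rule modus ponens, and the axiom schemes $X \supset (Y \supset X)$, $[X \supset (Y \supset Z)] \supset [(X \supset Y) \supset (X \supset Z)]$ and $[(X \supset Y) \supset X] \supset X$. For an IPC formula $Z$ write $QZ := Z \supset Q$. For a sequence $\theta = (Z_N, \dots, Z_0)$ of IPC formulas, $\mathcal{D}(\theta) := Z_N \supset (Z_{N-1} \supset ( \cdots (Z_0 \supset Q) \cdots ))$, and for a formula $W$, $(W,\theta)$ denotes the sequence $(W, Z_N, \dots, Z_0)$, so $\mathcal{D}(W,\theta) = W \supset \mathcal{D}(\theta)$. *)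

theory Defs
  imports Main
begin

datatype 'v ipc = Var 'v | Imp "'v ipc" "'v ipc" (infixr "\<^bold>\<supset>" 65)

inductive ipc_theorem :: "'v ipc \<Rightarrow> bool" where
  ax_K: "ipc_theorem (X \<^bold>\<supset> (Y \<^bold>\<supset> X))"
| ax_S: "ipc_theorem ((X \<^bold>\<supset> (Y \<^bold>\<supset> Z)) \<^bold>\<supset> ((X \<^bold>\<supset> Y) \<^bold>\<supset> (X \<^bold>\<supset> Z)))"
| ax_Peirce: "ipc_theorem (((X \<^bold>\<supset> Y) \<^bold>\<supset> X) \<^bold>\<supset> X)"
| modus_ponens: "ipc_theorem (X \<^bold>\<supset> Y) \<Longrightarrow> ipc_theorem X \<Longrightarrow> ipc_theorem Y"

definition Qneg :: "'v ipc \<Rightarrow> 'v ipc \<Rightarrow> 'v ipc" where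
  "Qneg Q Z = (Z \<^bold>\<supset> Q)"

text \<open>A sequence $(Z_N, \dots, Z_0)$ is represented by the list with head $Z_N$ and last element
  $Z_0$, so that $(W,\theta)$ is \<open>W # \<theta>\<close>.\<close>

primrec \<D> :: "'v ipc \<Rightarrow> 'v ipc list \<Rightarrow> 'v ipc" where
  "\<D> Q [] = Q"
| "\<D> Q (Z # \<theta>) = (Z \<^bold>\<supset> \<D> Q \<theta>)"

end

theory Submission
  imports Defs
begin

text \<open>By the deduction theorem, \<open>\<D> Q \<theta>\<close> is a theorem iff \<open>Q\<close> is derivable from the terms
  of \<open>\<theta>\<close>. Both \<open>\<alpha>0\<close> and \<open>\<alpha>1\<close> are derivable from \<open>\<alpha>\<close>, so as additional hypotheses they can
  be cut. Only \<open>\<alpha>0\<close> needs Peirce's law: from \<open>(X \<supset> Y) \<supset> Q\<close> and \<open>X \<supset> Q\<close> one gets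
  \<open>(Q \<supset> Y) \<supset> Q\<close>, hence \<open>Q\<close>.\<close>

inductive derives :: "'v ipc set \<Rightarrow> 'v ipc \<Rightarrow> bool" (infix "\<turnstile>" 50) for \<Gamma> where
  derives_assm: "A \<in> \<Gamma> \<Longrightarrow> \<Gamma> \<turnstile> A"
| derives_theorem: "ipc_theorem A \<Longrightarrow> \<Gamma> \<turnstile> A"
| derives_mp: "\<Gamma> \<turnstile> A \<^bold>\<supset> B \<Longrightarrow> \<Gamma> \<turnstile> A \<Longrightarrow> \<Gamma> \<turnstile> B"

lemma derives_empty_iff: "{} \<turnstile> A \<longleftrightarrow> ipc_theorem A"
proof
  assume "{} \<turnstile> A"
  then show "ipc_theorem A"
    by induction (auto intro: modus_ponens)
qed (rule derives_theorem)

lemma derives_trans: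
  assumes "\<Gamma> \<turnstile> A" and "\<And>B. B \<in> \<Gamma> \<Longrightarrow> \<Delta> \<turnstile> B"
  shows "\<Delta> \<turnstile> A"
  using assms(1)
proof induction
  case (derives_assm A)
  then show ?case
    by (rule assms(2))
next
  case (derives_theorem A)
  then show ?case
    by (rule derives.derives_theorem)
next
  case (derives_mp A B)
  show ?case
    using derives_mp.IH by (rule derives.derives_mp)
qed

lemma derives_mono: "\<Gamma> \<turnstile> A \<Longrightarrow> \<Gamma> \<subseteq> \<Delta> \<Longrightarrow> \<Delta> \<turnstile> A"
  by (blast intro: derives_trans derives_assm)

lemma derives_cut: "insert A \<Gamma> \<turnstile> B \<Longrightarrow> \<Gamma> \<turnstile> A \<Longrightarrow> \<Gamma> \<turnstile> B"
  by (erule derives_trans) (auto intro: derives_assm)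

lemma derives_Imp_consequent: "\<Gamma> \<turnstile> B \<Longrightarrow> \<Gamma> \<turnstile> A \<^bold>\<supset> B"
  by (rule derives_mp[OF derives_theorem[OF ax_K]])

lemma derives_Imp_mp: "\<Gamma> \<turnstile> A \<^bold>\<supset> (B \<^bold>\<supset> C) \<Longrightarrow> \<Gamma> \<turnstile> A \<^bold>\<supset> B \<Longrightarrow> \<Gamma> \<turnstile> A \<^bold>\<supset> C"
  by (rule derives_mp[OF derives_mp[OF derives_theorem[OF ax_S]]])

lemma derives_Imp_refl: "\<Gamma> \<turnstile> A \<^bold>\<supset> A"
  by (rule derives_Imp_mp[of _ _ "A \<^bold>\<supset> A"]) (rule derives_theorem, rule ax_K)+

lemma deduction_theorem: "\<Gamma> \<turnstile> A \<^bold>\<supset> B \<longleftrightarrow> insert A \<Gamma> \<turnstile> B"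
proof
  assume "\<Gamma> \<turnstile> A \<^bold>\<supset> B"
  then have "insert A \<Gamma> \<turnstile> A \<^bold>\<supset> B"
    by (rule derives_mono) blast
  then show "insert A \<Gamma> \<turnstile> B"
    by (rule derives_mp) (simp add: derives_assm)
next
  assume "insert A \<Gamma> \<turnstile> B"
  then show "\<Gamma> \<turnstile> A \<^bold>\<supset> B"
  proof induction
    case (derives_assm B)
    then consider "B = A" | "B \<in> \<Gamma>"
      by blast
    then show ?case
      by cases (auto intro: derives_Imp_refl derives_Imp_consequent derives.derives_assm)
  next
    case (derives_theorem B)
    then show ?case
      by (intro derives_Imp_consequent derives.derives_theorem)
  next
    case (derives_mp B C)
    show ?case
      using derives_mp.IH by (rule derives_Imp_mp)
  qed
qed

lemmas derives_ImpI = deduction_theorem[THEN iffD2]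

lemma derives_Peirce:
  assumes "insert (A \<^bold>\<supset> B) \<Gamma> \<turnstile> A"
  shows "\<Gamma> \<turnstile> A"
proof (rule derives_mp)
  show "\<Gamma> \<turnstile> ((A \<^bold>\<supset> B) \<^bold>\<supset> A) \<^bold>\<supset> A"
    by (rule derives_theorem[OF ax_Peirce])
  show "\<Gamma> \<turnstile> (A \<^bold>\<supset> B) \<^bold>\<supset> A"
    using assms by (rule derives_ImpI)
qed

lemma derives_Qneg_Qneg_antecedent:
  assumes "\<Gamma> \<turnstile> Qneg Q (X \<^bold>\<supset> Y)"
  shows "\<Gamma> \<turnstile> Qneg Q (Qneg Q X)"
proof -
  let ?\<Delta> = "insert (Q \<^bold>\<supset> Y) (insert (X \<^bold>\<supset> Q) \<Gamma>)"
  have "insert X ?\<Delta> \<turnstile> Q"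
    by (rule derives_mp[of _ X]) (simp_all add: derives_assm)
  then have "insert X ?\<Delta> \<turnstile> Y"
    by (rule derives_mp[rotated]) (simp add: derives_assm)
  then have "?\<Delta> \<turnstile> X \<^bold>\<supset> Y"
    by (rule derives_ImpI)
  moreover have "?\<Delta> \<turnstile> (X \<^bold>\<supset> Y) \<^bold>\<supset> Q"
    using assms unfolding Qneg_def by (rule derives_mono) blast
  ultimately have "?\<Delta> \<turnstile> Q"
    by (rule derives_mp[rotated])
  then have "insert (X \<^bold>\<supset> Q) \<Gamma> \<turnstile> Q"
    by (rule derives_Peirce)
  then show ?thesis
    unfolding Qneg_def by (rule derives_ImpI)
qed

lemma derives_Qneg_consequent:
  assumes "\<Gamma> \<turnstile> Qneg Q (X \<^bold>\<supset> Y)"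
  shows "\<Gamma> \<turnstile> Qneg Q Y"
proof -
  have "insert Y \<Gamma> \<turnstile> X \<^bold>\<supset> Y"
    by (rule derives_Imp_consequent) (simp add: derives_assm)
  moreover have "insert Y \<Gamma> \<turnstile> (X \<^bold>\<supset> Y) \<^bold>\<supset> Q"
    using assms unfolding Qneg_def by (rule derives_mono) blast
  ultimately have "insert Y \<Gamma> \<turnstile> Q"
    by (rule derives_mp[rotated])
  then show ?thesis
    unfolding Qneg_def by (rule derives_ImpI)
qed

lemma derives_\<D>_iff: "\<Gamma> \<turnstile> \<D> Q \<theta> \<longleftrightarrow> set \<theta> \<union> \<Gamma> \<turnstile> Q"
  by (induction \<theta> arbitrary: \<Gamma>) (simp_all add: deduction_theorem)

lemma ipc_theorem_\<D>_iff: "ipc_theorem (\<D> Q \<theta>) \<longleftrightarrow> set \<theta> \<turnstile> Q"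
  using derives_\<D>_iff[of "{}" Q \<theta>] by (simp add: derives_empty_iff)

lemma ipc_theorem_\<D>_cut:
  assumes "ipc_theorem (\<D> Q (A # \<theta>))" and "set \<theta> \<turnstile> A"
  shows "ipc_theorem (\<D> Q \<theta>)"
  using assms derives_cut unfolding ipc_theorem_\<D>_iff by simp

theorem theorem8:
  fixes Q X Y :: "'v ipc" and \<theta> :: "'v ipc list" and \<alpha> \<alpha>0 \<alpha>1 :: "'v ipc"
  assumes "\<forall>Z \<in> set \<theta>. \<exists>W. Z = Qneg Q W \<or> Z = Qneg Q (Qneg Q W)"
    and "\<alpha> \<in> set \<theta>"
    and "\<alpha> = Qneg Q (X \<^bold>\<supset> Y)"
    and "\<alpha>0 = Qneg Q (Qneg Q X)"
    and "\<alpha>1 = Qneg Q Y"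
    and "ipc_theorem (\<D> Q (\<alpha>0 # \<theta>)) \<or> ipc_theorem (\<D> Q (\<alpha>1 # \<theta>))"
  shows "ipc_theorem (\<D> Q \<theta>)"
proof -
  have \<alpha>: "set \<theta> \<turnstile> Qneg Q (X \<^bold>\<supset> Y)"
    using assms(2,3) by (simp add: derives_assm)
  have "set \<theta> \<turnstile> \<alpha>0"
    unfolding assms(4) using \<alpha> by (rule derives_Qneg_Qneg_antecedent)
  moreover have "set \<theta> \<turnstile> \<alpha>1"
    unfolding assms(5) using \<alpha> by (rule derives_Qneg_consequent)
  ultimately show ?thesis
    using assms(6) by (blast intro: ipc_theorem_\<D>_cut)
qed

end
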